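(* Let $n,k,d$ be non-negative integers with $k>0$ and $n>d$, and let $G$ be an $(n,k,d)$-graph. For a new vertex $x\notin V(G)$, let $G+x$ denote the graph obtained from $G$ by adding $x$ and joining $x$ to every vertex of $G$. Then $G+x$ is an $(n+1,k-1,d)$-graph.
   Context: All graphs are finite, undirected and simple. A $k$-matching is a matching with exactly $k$ edges. For a non-negative integer $d$, a defect-$d$ matching of a graph $H$ is a matching covering exactly $|V(H)|-d$ vertices of $H$. A matching $M$ extends to a matching $M'$ if $M\subseteq M'$. Let $n,k,d$ be non-negative integers. A graph $G$ is an $(n,k,d)$-graph if $|V(G)|\geq n+2k+d+2$, $|V(G)|-n-d$ is even, and for every set $S$ of $n$ vertices of $G$, the graph $H=G-S$ contains a $k$-matching and every $k$-matching of $H$ can be extended to a defect-$d$ matching of $H$. *)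

theory Defs
  imports Main
begin

record 'a ugraph =
  verts :: "'a set"
  edges :: "'a set set"

definition simple_graph :: "'a ugraph \<Rightarrow> bool" where
  "simple_graph G \<longleftrightarrow> finite (verts G) \<and> (\<forall>e\<in>edges G. e \<subseteq> verts G \<and> card e = 2)"

definition matching :: "'a ugraph \<Rightarrow> 'a set set \<Rightarrow> bool" where
  "matching G M \<longleftrightarrow> M \<subseteq> edges G \<and> (\<forall>e\<in>M. \<forall>f\<in>M. e \<noteq> f \<longrightarrow> e \<inter> f = {})"

definition k_matching :: "nat \<Rightarrow> 'a ugraph \<Rightarrow> 'a set set \<Rightarrow> bool" where
  "k_matching k G M \<longleftrightarrow> matching G M \<and> card M = k"

(* The set of covered vertices is \<Union>M. The defect is added on the left rather than
   subtracted on the right so that no truncated subtraction occurs: if d exceeds the number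
   of vertices, there is no defect-d matching. *)
definition defect_matching :: "nat \<Rightarrow> 'a ugraph \<Rightarrow> 'a set set \<Rightarrow> bool" where
  "defect_matching d G M \<longleftrightarrow> matching G M \<and> card (\<Union>M) + d = card (verts G)"

definition delete_verts :: "'a ugraph \<Rightarrow> 'a set \<Rightarrow> 'a ugraph" where
  "delete_verts G S = \<lparr>verts = verts G - S, edges = {e \<in> edges G. e \<inter> S = {}}\<rparr>"

(* G + x; only meaningful for x not in verts G. *)
definition add_vertex :: "'a ugraph \<Rightarrow> 'a \<Rightarrow> 'a ugraph" where
  "add_vertex G x = \<lparr>verts = insert x (verts G), edges = edges G \<union> {{x, v} | v. v \<in> verts G}\<rparr>"

(* The first cardinality condition makes the natural-number subtraction in the second one exact. *)
definition nkd_graph :: "nat \<Rightarrow> nat \<Rightarrow> nat \<Rightarrow> 'a ugraph \<Rightarrow> bool" where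
  "nkd_graph n k d G \<longleftrightarrow>
     simple_graph G \<and>
     card (verts G) \<ge> n + 2 * k + d + 2 \<and>
     even (card (verts G) - n - d) \<and>
     (\<forall>S. S \<subseteq> verts G \<and> card S = n \<longrightarrow>
        (\<exists>M. k_matching k (delete_verts G S) M) \<and>
        (\<forall>M. k_matching k (delete_verts G S) M \<longrightarrow>
           (\<exists>M'. M \<subseteq> M' \<and> defect_matching d (delete_verts G S) M')))"

end

theory Submission
  imports Defs
begin

text \<open>
  Let \<open>S\<close> be the deleted set of \<open>n + 1\<close> vertices of \<open>G + x\<close>. If \<open>x \<in> S\<close>, the claim is that
  \<open>k\<close>-extendability implies \<open>(k - 1)\<close>-extendability. If \<open>x \<notin> S\<close> and \<open>x\<close> is not covered by the
  matching, \<open>x\<close> can play the role of any \<open>s \<in> S\<close>.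

  The remaining case is a matching \<open>M0 \<union> {xv}\<close>. Put \<open>I = S \<union> {v}\<close>, so \<open>|I| = n + 2\<close>, and suppose that
  \<open>Q = V(G) - I - V(M0)\<close> has no defect-\<open>d\<close> matching. By parity and the Tutte--Berge formula there is
  \<open>T \<subseteq> Q\<close> such that \<open>Q - T\<close> has at least \<open>|T| + d + 2\<close> odd components. With \<open>X = T \<union> I\<close> this is a tight
  configuration: there are exactly \<open>|X| - n + d\<close> odd blocks. Extendability of 1- and 2-matchings
  forces \<open>X\<close> to be independent and the edges between \<open>X\<close> and each block to form a star.
  Deleting the centres of all these stars isolates the remainder of \<open>X\<close>, and counting the resulting
  odd components yields \<open>n \<le> d\<close>.
\<close>

section \<open>Matchings inside a vertex set\<close>

text \<open>The edge set stays fixed while the vertex set is a parameter, so deleting vertices only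
  shrinks \<open>V\<close>, and the same lemmas serve \<open>G\<close> and
  \<open>G + x\<close>.\<close>

locale edge_set =
  fixes E :: "'a set set"
  assumes card_edge: "e \<in> E \<Longrightarrow> card e = 2"
begin

definition matches :: "'a set \<Rightarrow> 'a set set \<Rightarrow> bool" where
  "matches V M \<longleftrightarrow> M \<subseteq> E \<and> \<Union>M \<subseteq> V \<and> (\<forall>e\<in>M. \<forall>f\<in>M. e \<noteq> f \<longrightarrow> e \<inter> f = {})"

definition max_matching :: "'a set \<Rightarrow> 'a set set \<Rightarrow> bool" where
  "max_matching V M \<longleftrightarrow> matches V M \<and> (\<forall>N. matches V N \<longrightarrow> card N \<le> card M)"

lemma matches_empty [simp]: "matches V {}"
  by (simp add: matches_def)

lemma matchesI:
  "M \<subseteq> E \<Longrightarrow> \<Union>M \<subseteq> V \<Longrightarrow> (\<And>e f v. e \<in> M \<Longrightarrow> f \<in> M \<Longrightarrow> v \<in> e \<Longrightarrow> v \<in> f \<Longrightarrow> e = f) \<Longrightarrow> matches V M"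
  by (simp add: matches_def disjoint_iff) metis

lemma matches_disjoint:
  "matches V M \<Longrightarrow> e \<in> M \<Longrightarrow> f \<in> M \<Longrightarrow> v \<in> e \<Longrightarrow> v \<in> f \<Longrightarrow> e = f"
  by (simp add: matches_def disjoint_iff) metis

lemma matches_edge: "matches V M \<Longrightarrow> e \<in> M \<Longrightarrow> e \<in> E \<and> e \<subseteq> V"
  by (auto simp: matches_def)

lemma matches_restrict: "matches V M \<Longrightarrow> \<Union>M \<subseteq> W \<Longrightarrow> matches W M"
  by (simp add: matches_def)

lemma matches_Union: "matches V M \<Longrightarrow> \<Union>M \<subseteq> V"
  by (simp add: matches_def)

lemma matches_mono: "matches V M \<Longrightarrow> V \<subseteq> W \<Longrightarrow> matches W M"
  using matches_restrict matches_Union subset_trans by metis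

lemma matches_subset:
  assumes "matches V M" "N \<subseteq> M" shows "matches V N"
proof (rule matchesI)
  show "N \<subseteq> E" "\<Union>N \<subseteq> V" using assms matches_edge by blast+
next
  fix e f v assume "e \<in> N" "f \<in> N" "v \<in> e" "v \<in> f"
  then show "e = f" using assms(2) by (intro matches_disjoint[OF assms(1)]) auto
qed

lemma edge_other:
  assumes "e \<in> E" "v \<in> e" obtains w where "e = {v, w}" "w \<noteq> v"
  using card_edge[OF assms(1)] assms(2) by (auto simp: card_2_iff)

lemma matches_Un:
  assumes "matches V M" "matches W N" "\<Union>M \<inter> \<Union>N = {}" shows "matches (V \<union> W) (M \<union> N)"
proof (rule matchesI)
  show "M \<union> N \<subseteq> E" using assms(1,2) by (auto simp: matches_def)
  show "\<Union>(M \<union> N) \<subseteq> V \<union> W"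
    using matches_Union[OF assms(1)] matches_Union[OF assms(2)] by (simp add: le_supI1 le_supI2)
next
  fix e f v assume ef: "e \<in> M \<union> N" "f \<in> M \<union> N" "v \<in> e" "v \<in> f"
  then consider "e \<in> M" "f \<in> M" | "e \<in> N" "f \<in> N" using assms(3) by blast
  then show "e = f"
    using matches_disjoint[OF assms(1) _ _ ef(3,4)] matches_disjoint[OF assms(2) _ _ ef(3,4)] by cases
qed

lemma matches_insert:
  assumes "matches V M" "e \<in> E" "e \<subseteq> V" "e \<inter> \<Union>M = {}" shows "matches V (insert e M)"
proof -
  have "matches V {e}" using assms(2,3) by (simp add: matches_def)
  from matches_Un[OF this assms(1)] show ?thesis using assms(4) by simp
qed

lemma matches_Diff_disjoint:
  assumes "matches V M" "N \<subseteq> M" shows "\<Union>(M - N) \<inter> \<Union>N = {}"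
proof -
  have "e \<in> N" if "e \<in> M" "f \<in> N" "v \<in> e" "v \<in> f" for e f v
    using matches_disjoint[OF assms(1) that(1) _ that(3,4)] assms(2) that(2) by blast
  then show ?thesis by blast
qed

lemma matches_finite: "finite V \<Longrightarrow> matches V M \<Longrightarrow> finite M"
  unfolding matches_def using finite_UnionD[OF finite_subset[of "\<Union>M" V]] by simp

lemma card_Union_matches:
  assumes "matches V M" shows "card (\<Union>M) = 2 * card M"
proof -
  have "finite e" if "e \<in> M" for e
    using matches_edge[OF assms that] card_edge[of e] by (simp add: card_ge_0_finite)
  moreover have "pairwise disjnt M"
    using assms by (simp add: matches_def pairwise_def disjnt_def)
  ultimately have "card (\<Union>M) = sum card M" by (rule card_Union_disjoint[rotated])
  also have "\<dots> = sum (\<lambda>_. 2) M"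
    using assms card_edge by (intro sum.cong) (auto simp: matches_def)
  finally show ?thesis by simp
qed

lemma card_uncovered:
  assumes "finite V" "matches V M" shows "card (V - \<Union>M) + 2 * card M = card V"
proof -
  have "\<Union>M \<subseteq> V" using assms(2) by (simp add: matches_def)
  then have "card (V - \<Union>M) = card V - card (\<Union>M)" "card (\<Union>M) \<le> card V"
    using card_Diff_subset[OF finite_subset] card_mono assms(1) by blast+
  with card_Union_matches[OF assms(2)] show ?thesis by linarith
qed

lemma card_matches_insert:
  assumes "finite V" "matches V M" "e \<in> E" "e \<inter> \<Union>M = {}"
  shows "card (insert e M) = Suc (card M)"
proof -
  have "e \<noteq> {}" using card_edge[OF assms(3)] by auto
  then have "e \<notin> M" using assms(4) by blast
  then show ?thesis using matches_finite[OF assms(1,2)] by simp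
qed

lemma card_matches_le:
  assumes "finite V" "matches V M" shows "card M \<le> card V"
  using card_uncovered[OF assms] by linarith

lemma ex_max_matching: "finite V \<Longrightarrow> \<exists>M. max_matching V M"
  unfolding max_matching_def
  by (rule ex_has_greatest_nat[of _ "{}" _ "Suc (card V)"]) (simp_all add: card_matches_le le_imp_less_Suc)

lemma max_matching_no_edge:
  assumes "finite V" "max_matching V M" "{u, v} \<in> E" "u \<in> V" "v \<in> V" "u \<notin> \<Union>M"
  shows "v \<in> \<Union>M"
proof (rule ccontr)
  assume "v \<notin> \<Union>M"
  with assms have d: "{u, v} \<inter> \<Union>M = {}" and "matches V M" by (auto simp: max_matching_def)
  then have "matches V (insert {u, v} M)" "card (insert {u, v} M) = Suc (card M)"
    using assms by (auto intro!: matches_insert card_matches_insert simp del: Union_iff)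
  then show False using assms(2) unfolding max_matching_def by fastforce
qed

section \<open>Exchanging a single edge\<close>

text \<open>\<open>f\<close> is the edge at \<open>z\<close> if \<open>z\<close> is covered, and any
  edge otherwise. In both cases dropping \<open>f\<close> makes room for \<open>{y, z}\<close> at
  constant size.\<close>

lemma matches_swap:
  assumes "finite V" "matches V N" "{y, z} \<in> E" "y \<in> V" "z \<in> V" "y \<notin> \<Union>N" "f \<in> N"
    and "z \<in> \<Union>N \<Longrightarrow> z \<in> f"
  shows "matches V (insert {y, z} (N - {f}))" "card (insert {y, z} (N - {f})) = card N"
proof -
  have m: "matches V (N - {f})" by (rule matches_subset[OF assms(2)]) auto
  have d: "{y, z} \<inter> \<Union>(N - {f}) = {}"
    using assms matches_disjoint[OF assms(2) assms(7)] by blast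
  show "matches V (insert {y, z} (N - {f}))"
    using assms m d by (intro matches_insert) auto
  show "card (insert {y, z} (N - {f})) = card N"
    using card_matches_insert[OF assms(1) m assms(3) d] matches_finite[OF assms(1,2)] assms(7)
    by (simp add: card_Suc_Diff1 del: card_Diff_insert)
qed

text \<open>Among the matchings of the size of \<open>N\<close>, take one sharing the most edges
  with \<open>M\<close>. If it missed an endpoint of an edge of \<open>M\<close>, exchanging that
  edge for one outside \<open>M\<close> would increase the overlap.\<close>

lemma matching_cover_extend:
  assumes "finite V" "matches V M" "matches V N" "card M \<le> card N"
  shows "\<exists>N'. matches V N' \<and> card N' = card N \<and> \<Union>M \<subseteq> \<Union>N'"
proof -
  let ?P = "\<lambda>N'. matches V N' \<and> card N' = card N"
  have finM: "finite M" using matches_finite assms by blast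
  have "\<forall>N'. ?P N' \<longrightarrow> card (M \<inter> N') < Suc (card M)"
    using card_mono[OF finM Int_lower1] by (simp add: less_Suc_eq_le)
  moreover have "?P N" using assms(3) by simp
  ultimately have "\<exists>K. ?P K \<and> (\<forall>N'. ?P N' \<longrightarrow> card (M \<inter> N') \<le> card (M \<inter> K))"
    by (intro ex_has_greatest_nat[of ?P N])
  then obtain K where K: "matches V K" "card K = card N"
    and mx: "\<And>N'. matches V N' \<Longrightarrow> card N' = card N \<Longrightarrow> card (M \<inter> N') \<le> card (M \<inter> K)"
    by metis
  have "\<Union>M \<subseteq> \<Union>K"
  proof (rule ccontr)
    assume "\<not> \<Union>M \<subseteq> \<Union>K"
    then obtain e y where e: "e \<in> M" "y \<in> e" "y \<notin> \<Union>K" by blast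
    then have eE: "e \<in> E" "e \<subseteq> V" using matches_edge[OF assms(2)] by auto
    obtain z where z: "e = {y, z}" "z \<noteq> y" using edge_other[OF eE(1) e(2)] .
    have eK: "e \<notin> K" using e by blast
    have "\<exists>f\<in>K - M. z \<in> \<Union>K \<longrightarrow> z \<in> f"
    proof (cases "z \<in> \<Union>K")
      case True
      then obtain f where f: "f \<in> K" "z \<in> f" by blast
      then have "f \<noteq> e" using eK by blast
      then have "f \<notin> M" using matches_disjoint[OF assms(2) e(1), of f z] f z by auto
      with f show ?thesis by blast
    next
      case False
      \<comment> \<open>\<open>K\<close> is at least as large as \<open>M\<close> and lacks
        \<open>e\<close>, so it has an edge outside \<open>M\<close> that may be given up.\<close>
      have "\<not> K \<subseteq> M"
      proof
        assume "K \<subseteq> M"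
        then have "K \<subset> M" using e(1) eK by blast
        then have "card K < card M" by (rule psubset_card_mono[OF finM])
        then show False using K(2) assms(4) by simp
      qed
      with False show ?thesis by blast
    qed
    then obtain f where f: "f \<in> K" "f \<notin> M" "z \<in> \<Union>K \<Longrightarrow> z \<in> f" by blast
    have "y \<in> V" "z \<in> V" "{y, z} \<in> E" using eE z(1) by auto
    note swap = matches_swap[OF assms(1) K(1) this(3,1,2) e(3) f(1,3)]
    have "card (M \<inter> insert e (K - {f})) \<le> card (M \<inter> K)"
      using mx swap K(2) z(1) by simp
    moreover have "M \<inter> insert e (K - {f}) = insert e (M \<inter> K)" using e(1) f(2) by blast
    ultimately show False using eK finM by simp
  qed
  with K show ?thesis by blast
qed

section \<open>Extendability of smaller matchings\<close>

definition extendable :: "nat \<Rightarrow> nat \<Rightarrow> 'a set \<Rightarrow> bool" where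
  "extendable k d V \<longleftrightarrow> (\<exists>M. matches V M \<and> card M = k) \<and>
     (\<forall>M. matches V M \<and> card M = k \<longrightarrow> (\<exists>M'. M \<subseteq> M' \<and> matches V M' \<and> card (V - \<Union>M') = d))"

text \<open>By \<open>matching_cover_extend\<close>, some \<open>(k+1)\<close>-matching covers everything that a given \<open>k\<close>-matching
  covers. Its extension contains a further edge, which is disjoint from the \<open>k\<close>-matching.\<close>

lemma extendable_Suc:
  assumes fin: "finite V" and ext: "extendable (Suc k) d V" and big: "2 * Suc k + d < card V"
  shows "extendable k d V"
proof -
  obtain N where N: "matches V N" "card N = Suc k" using ext by (auto simp: extendable_def)
  have "\<exists>M'. M \<subseteq> M' \<and> matches V M' \<and> card (V - \<Union>M') = d"
    if M: "matches V M" "card M = k" for M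
  proof -
    obtain K where K: "matches V K" "card K = Suc k" "\<Union>M \<subseteq> \<Union>K"
      using matching_cover_extend[OF fin M(1) N(1)] M N by auto
    then obtain D where D: "K \<subseteq> D" "matches V D" "card (V - \<Union>D) = d"
      using ext unfolding extendable_def by blast
    have "card K < card D" using card_uncovered[OF fin D(2)] big unfolding D(3) K(2) by simp
    then obtain f where f: "f \<in> D" "f \<notin> K" using D(1) by (metis less_irrefl subsetI subset_antisym)
    then have d: "f \<inter> \<Union>M = {}" using matches_Diff_disjoint[OF D(2,1)] K(3) by blast
    have fE: "f \<in> E" "f \<subseteq> V" using matches_edge[OF D(2) f(1)] by auto
    have "matches V (insert f M) \<and> card (insert f M) = Suc k"
      using matches_insert[OF M(1) fE d] card_matches_insert[OF fin M(1) fE(1) d] M(2) by simp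
    then show ?thesis using ext unfolding extendable_def by blast
  qed
  moreover have "\<exists>M. matches V M \<and> card M = k"
  proof -
    obtain M where "M \<subseteq> N" "card M = k" using N(2) obtain_subset_with_card_n[of k N] by auto
    then show ?thesis using matches_subset[OF N(1)] by blast
  qed
  ultimately show ?thesis by (auto simp: extendable_def)
qed

lemma extendable_le:
  assumes "finite V" "2 * k + d < card V" "j \<le> k" "extendable k d V"
  shows "extendable j d V"
  using assms(3,2,4)
proof (induction k rule: dec_induct)
  case (step k)
  have "extendable k d V" by (rule extendable_Suc[OF assms(1) step.prems(2,1)])
  then show ?case using step.IH step.prems(1) by simp
qed simp

section \<open>Odd blocks and the Tutte--Berge formula\<close>

text \<open>The matching edges that meet \<open>C\<close> partition it into pairs.\<close>

lemma even_closed_covered: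
  assumes "finite C" "matches V M" "C \<subseteq> \<Union>M" "\<And>e. e \<in> M \<Longrightarrow> e \<inter> C \<noteq> {} \<Longrightarrow> e \<subseteq> C"
  shows "even (card C)"
proof -
  let ?N = "{e \<in> M. e \<inter> C \<noteq> {}}"
  have "matches V ?N" by (rule matches_subset[OF assms(2)]) auto
  then have "even (card (\<Union>?N))" using card_Union_matches by simp
  moreover have "\<Union>?N = C"
  proof
    show "\<Union>?N \<subseteq> C" using assms(4) by (intro Union_least) simp
    show "C \<subseteq> \<Union>?N" using assms(3) by fast
  qed
  ultimately show ?thesis by simp
qed

text \<open>Being a union of components of odd total size suffices for the counting, so connectedness is
  never needed.\<close>

definition odd_blocks :: "'a set \<Rightarrow> 'a set \<Rightarrow> 'a set set \<Rightarrow> bool" where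
  "odd_blocks V T \<C> \<longleftrightarrow> T \<subseteq> V \<and> \<Union>\<C> \<subseteq> V - T \<and>
     (\<forall>C\<in>\<C>. \<forall>D\<in>\<C>. C \<noteq> D \<longrightarrow> C \<inter> D = {}) \<and> (\<forall>C\<in>\<C>. odd (card C)) \<and>
     (\<forall>C\<in>\<C>. \<forall>e\<in>E. e \<subseteq> V \<longrightarrow> e \<inter> C \<noteq> {} \<longrightarrow> e \<subseteq> C \<union> T)"

text \<open>The easy half of Tutte--Berge. By parity each block contains an uncovered vertex or
  sends a matching edge into \<open>T\<close>. Choosing such a vertex, in the block or in
  \<open>T\<close>, is injective: blocks are disjoint, and a vertex of \<open>T\<close> lies on at
  most one matching edge.\<close>

lemma odd_blocks_le:
  assumes fin: "finite V" and ob: "odd_blocks V T \<C>" and M: "matches V M"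
  shows "card \<C> \<le> card (V - \<Union>M) + card T"
proof -
  have "\<exists>v. (v \<in> C \<and> v \<in> V - \<Union>M) \<or> (v \<in> T \<and> (\<exists>c\<in>C. {v, c} \<in> M))" if C: "C \<in> \<C>" for C
  proof (rule ccontr)
    assume no: "\<not> ?thesis"
    have CV: "C \<subseteq> V" using ob C by (auto simp: odd_blocks_def)
    have "even (card C)"
    proof (rule even_closed_covered[OF _ M])
      show "finite C" using CV fin finite_subset by blast
      show "C \<subseteq> \<Union>M" using no CV by blast
    next
      fix e assume e: "e \<in> M" "e \<inter> C \<noteq> {}"
      then obtain c where c: "c \<in> e" "c \<in> C" by blast
      have eE: "e \<in> E" "e \<subseteq> V" using matches_edge[OF M e(1)] by auto
      obtain w where w: "e = {c, w}" using edge_other[OF eE(1) c(1)] by blast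
      have "e \<subseteq> C \<union> T" using ob C eE e(2) by (simp add: odd_blocks_def)
      moreover have "w \<notin> T" using no c w e(1) by (auto simp: insert_commute)
      ultimately show "e \<subseteq> C" using w c by blast
    qed
    then show False using ob C by (simp add: odd_blocks_def)
  qed
  then obtain g where g: "\<And>C. C \<in> \<C> \<Longrightarrow>
      (g C \<in> C \<and> g C \<in> V - \<Union>M) \<or> (g C \<in> T \<and> (\<exists>c\<in>C. {g C, c} \<in> M))" by metis
  have disj: "C = D" if "C \<in> \<C>" "D \<in> \<C>" "c \<in> C" "c \<in> D" for C D c
    using ob that unfolding odd_blocks_def disjoint_iff by metis
  have notT: "C \<inter> T = {}" if "C \<in> \<C>" for C
    using ob that unfolding odd_blocks_def by auto
  have "inj_on g \<C>"
  proof
    fix C D assume CD: "C \<in> \<C>" "D \<in> \<C>" "g C = g D"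
    show "C = D"
    proof (cases "g C \<in> T")
      case True
      then obtain c c' where c: "c \<in> C" "{g C, c} \<in> M" "c' \<in> D" "{g C, c'} \<in> M"
        using g[OF CD(1)] g[OF CD(2)] CD notT by (metis disjoint_iff)
      then have "{g C, c} = {g C, c'}" using matches_disjoint[OF M] by blast
      then have "c = c'" by (auto simp: doubleton_eq_iff)
      then show ?thesis using disj CD c by blast
    next
      case False
      then show ?thesis using g[OF CD(1)] g[OF CD(2)] CD disj by metis
    qed
  qed
  moreover have "g ` \<C> \<subseteq> (V - \<Union>M) \<union> T" using g by blast
  moreover have "finite ((V - \<Union>M) \<union> T)"
    using fin ob finite_subset by (auto simp: odd_blocks_def)
  ultimately have "card \<C> \<le> card ((V - \<Union>M) \<union> T)" by (metis card_inj_on_le)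
  also have "\<dots> \<le> card (V - \<Union>M) + card T" by (rule card_Un_le)
  finally show ?thesis .
qed

text \<open>Among all pairs of a maximum matching missing \<open>u, w\<close> and one missing \<open>v\<close>, take one with the
  largest intersection; a vertex other than \<open>v\<close> missed by the second but not by the first
  then allows an exchange that enlarges the intersection.\<close>

lemma Gallai_lemma:
  assumes fin: "finite V" and V: "u \<in> V" "v \<in> V" "w \<in> V" "u \<noteq> w" "v \<noteq> u" "v \<noteq> w"
    and M0: "max_matching V M0" "u \<notin> \<Union>M0" "w \<notin> \<Union>M0"
    and N0: "max_matching V N0" "v \<notin> \<Union>N0"
    and uv: "\<And>K. max_matching V K \<Longrightarrow> v \<notin> \<Union>K \<Longrightarrow> u \<in> \<Union>K"
    and vw: "\<And>K. max_matching V K \<Longrightarrow> v \<notin> \<Union>K \<Longrightarrow> w \<in> \<Union>K"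
  shows False
proof -
  let ?P = "\<lambda>(M, N). max_matching V M \<and> u \<notin> \<Union>M \<and> w \<notin> \<Union>M \<and> max_matching V N \<and> v \<notin> \<Union>N"
  let ?f = "\<lambda>(M, N). card (M \<inter> N)"
  have bd: "card (M \<inter> N) < Suc (card V)" if "max_matching V M" for M N
  proof -
    have M: "matches V M" using that by (simp add: max_matching_def)
    have "card (M \<inter> N) \<le> card M" by (rule card_mono[OF matches_finite[OF fin M] Int_lower1])
    then show ?thesis using card_matches_le[OF fin M] by simp
  qed
  have "\<exists>p. ?P p \<and> (\<forall>q. ?P q \<longrightarrow> ?f q \<le> ?f p)"
  proof (rule ex_has_greatest_nat[of ?P "(M0, N0)" ?f "Suc (card V)"])
    show "?P (M0, N0)" using M0 N0 by simp
    show "\<forall>q. ?P q \<longrightarrow> ?f q < Suc (card V)" using bd by (simp split: prod.splits)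
  qed
  then obtain p where p: "?P p" "\<forall>q. ?P q \<longrightarrow> ?f q \<le> ?f p" by (elim exE conjE)
  obtain M N where pe: "p = (M, N)" by (cases p)
  have M: "max_matching V M" "u \<notin> \<Union>M" "w \<notin> \<Union>M" and N: "max_matching V N" "v \<notin> \<Union>N"
    using p(1) unfolding pe by simp_all
  have mx: "card (M \<inter> N') \<le> card (M \<inter> N)" if "max_matching V N'" "v \<notin> \<Union>N'" for N'
    using p(2)[rule_format, of "(M, N')"] that M unfolding pe by simp
  have mM: "matches V M" and mN: "matches V N" using M N by (simp_all add: max_matching_def)
  have eqc: "card M = card N" using M(1) N(1) mM mN unfolding max_matching_def by (intro antisym) simp_all
  have uN: "u \<in> \<Union>N" and wN: "w \<in> \<Union>N" using uv[OF N] vw[OF N] .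
  \<comment> \<open>\<open>M\<close> and \<open>N\<close> miss equally many vertices, and
    \<open>M\<close> misses \<open>u\<close> and \<open>w\<close>, which \<open>N\<close> covers.
    Hence \<open>N\<close> misses at least two vertices covered by \<open>M\<close>, one of them
    different from \<open>v\<close>.\<close>
  have "\<exists>x. x \<in> \<Union>M \<and> x \<noteq> v \<and> x \<notin> \<Union>N"
  proof (rule ccontr)
    assume no: "\<not> ?thesis"
    have "insert u (insert w (V - \<Union>N)) \<subseteq> insert v (V - \<Union>M)"
      using no M V by auto
    then have "card (insert u (insert w (V - \<Union>N))) \<le> card (insert v (V - \<Union>M))"
      using fin by (intro card_mono) simp_all
    moreover have "card (insert u (insert w (V - \<Union>N))) = Suc (Suc (card (V - \<Union>N)))"
      using fin uN wN V by simp
    moreover have "card (insert v (V - \<Union>M)) \<le> Suc (card (V - \<Union>M))"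
      by (rule card_insert_le_m1) simp_all
    ultimately show False
      using card_uncovered[OF fin mM] card_uncovered[OF fin mN] eqc by simp
  qed
  then obtain x where x: "x \<in> \<Union>M" "x \<noteq> v" "x \<notin> \<Union>N" by (elim exE conjE)
  obtain e where e: "e \<in> M" "x \<in> e" using x(1) by (rule UnionE)
  have eE: "e \<in> E" "e \<subseteq> V" using matches_edge[OF mM e(1)] by simp_all
  obtain y where y: "e = {x, y}" "y \<noteq> x" by (rule edge_other[OF eE(1) e(2)])
  have xy: "x \<in> V" "y \<in> V" "{x, y} \<in> E" using eE y(1) by simp_all
  have yN: "y \<in> \<Union>N" by (rule max_matching_no_edge[OF fin N(1) xy(3,1,2) x(3)])
  obtain f where f: "f \<in> N" "y \<in> f" using yN by (rule UnionE)
  have xf: "x \<notin> f" using x(3) f(1) by (simp add: Union_iff)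
  have fM: "f \<notin> M"
  proof
    assume "f \<in> M"
    then have "e = f" using matches_disjoint[OF mM e(1), of f y] f(2) y(1) by simp
    then show False using xf e(2) by simp
  qed
  \<comment> \<open>The exchange gains \<open>e\<close>, which is in \<open>M\<close>, and loses
    \<open>f\<close>, which is not. It still misses \<open>v\<close>, since \<open>y\<close> is
    covered by \<open>N\<close> and so differs from \<open>v\<close>.\<close>
  let ?N' = "insert {x, y} (N - {f})"
  note swap = matches_swap[OF fin mN xy(3,1,2) x(3) f(1) f(2)]
  have "max_matching V ?N'" using N(1) swap unfolding max_matching_def by simp
  moreover have "v \<noteq> y" using N(2) yN by metis
  then have "v \<notin> \<Union>?N'" using N(2) x(2) by simp
  ultimately have "card (M \<inter> ?N') \<le> card (M \<inter> N)" by (rule mx)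
  moreover have "M \<inter> ?N' = insert e (M \<inter> N)" using e(1) fM y(1) by auto
  moreover have "e \<notin> N" using x(3) e(2) by (simp add: Union_iff) metis
  ultimately show False using matches_finite[OF fin mM] by simp
qed

text \<open>The case of an empty separating set. A maximum matching missing \<open>u\<close> covers
  the rest of the class of \<open>u\<close>, and edges never leave a class, so classes are odd. Two
  vertices missed by \<open>M0\<close> lie in different classes, which gives the count.\<close>

lemma Tutte_Berge_all_missed:
  assumes fin: "finite V" and miss: "\<And>v. v \<in> V \<Longrightarrow> \<exists>M. max_matching V M \<and> v \<notin> \<Union>M"
    and M0: "max_matching V M0"
  shows "\<exists>\<C>. odd_blocks V {} \<C> \<and> \<Union>\<C> = V \<and> card (V - \<Union>M0) \<le> card \<C>"
proof -
  \<comment> \<open>By Gallai's lemma, ``no maximum matching misses both'' is transitive; its classes are the blocks.\<close>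
  define r where
    "r = {(a, b). a \<in> V \<and> b \<in> V \<and> (a = b \<or> (\<forall>M. max_matching V M \<longrightarrow> a \<in> \<Union>M \<or> b \<in> \<Union>M))}"
  have "refl_on V r" by (auto simp: refl_on_def r_def)
  moreover have "sym r" by (simp add: sym_def r_def disj_commute eq_commute)
  moreover have "trans r"
  proof (rule transI)
    fix a b c assume ab: "(a, b) \<in> r" and bc: "(b, c) \<in> r"
    have V: "a \<in> V" "b \<in> V" "c \<in> V" using ab bc by (simp_all add: r_def)
    show "(a, c) \<in> r"
    proof (cases "a = b \<or> b = c")
      case True
      then show ?thesis using ab bc by metis
    next
      case False
      then have cov: "\<And>K. max_matching V K \<Longrightarrow> b \<notin> \<Union>K \<Longrightarrow> a \<in> \<Union>K"
        "\<And>K. max_matching V K \<Longrightarrow> b \<notin> \<Union>K \<Longrightarrow> c \<in> \<Union>K"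
        using ab bc unfolding r_def by simp_all metis+
      obtain N where N: "max_matching V N" "b \<notin> \<Union>N" using miss[OF V(2)] by (elim exE conjE)
      have "a \<in> \<Union>M \<or> c \<in> \<Union>M" if "a \<noteq> c" "max_matching V M" for M
        using Gallai_lemma[OF fin V that(1) _ _ that(2) _ _ N cov] False by metis
      then show ?thesis using V unfolding r_def by simp metis
    qed
  qed
  moreover have "r \<subseteq> V \<times> V" by (auto simp: r_def)
  ultimately have eq: "equiv V r" by (simp add: equiv_def)
  have edge: "(a, b) \<in> r" if "{a, b} \<in> E" "a \<in> V" "b \<in> V" for a b
    using max_matching_no_edge[OF fin _ that] that(2,3) by (simp add: r_def) metis
  let ?C = "V // r"
  have closed: "e \<subseteq> C" if C: "C \<in> ?C" and e: "e \<in> E" "e \<subseteq> V" "e \<inter> C \<noteq> {}" for C e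
  proof -
    obtain a where a: "a \<in> e" "a \<in> C" using e(3) by auto
    obtain b where b: "e = {a, b}" by (rule edge_other[OF e(1) a(1)])
    then have "(a, b) \<in> r" using edge e by simp
    then have "b \<in> C" using in_quotient_imp_closed[OF eq C a(2)] by simp
    then show ?thesis using a b by simp
  qed
  have odd: "odd (card C)" if C: "C \<in> ?C" for C
  proof -
    have CV: "C \<subseteq> V" by (rule in_quotient_imp_subset[OF eq C])
    then have finC: "finite C" using fin by (rule finite_subset)
    obtain u where u: "u \<in> C" using in_quotient_imp_non_empty[OF eq C] by auto
    then obtain N where N: "max_matching V N" "u \<notin> \<Union>N" using miss[OF subsetD[OF CV u]] by (elim exE conjE)
    have mN: "matches V N" using N(1) by (simp add: max_matching_def)
    have "even (card (C - {u}))"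
    proof (rule even_closed_covered[OF _ mN])
      show "finite (C - {u})" using finC by simp
      show "C - {u} \<subseteq> \<Union>N"
      proof
        fix w assume w: "w \<in> C - {u}"
        then have "(u, w) \<in> r" using in_quotient_imp_in_rel[OF eq C] u by simp
        then have "u \<in> \<Union>N \<or> w \<in> \<Union>N" using N(1) w unfolding r_def by (simp, metis)
        then show "w \<in> \<Union>N" using N(2) by simp
      qed
    next
      fix e assume e: "e \<in> N" "e \<inter> (C - {u}) \<noteq> {}"
      then have "e \<subseteq> C" using matches_edge[OF mN e(1)] by (intro closed[OF C]) auto
      then show "e \<subseteq> C - {u}" using N(2) e(1) by auto
    qed
    moreover have "card C = Suc (card (C - {u}))" using card_Suc_Diff1[OF finC u] by simp
    ultimately show ?thesis by simp
  qed
  have un: "\<Union>?C = V" by (rule Union_quotient[OF eq])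
  have "odd_blocks V {} ?C"
    unfolding odd_blocks_def using un odd closed quotient_disj[OF eq] by simp metis
  moreover have "card (V - \<Union>M0) \<le> card ?C"
  proof (rule card_inj_on_le[of "\<lambda>v. r `` {v}"])
    show "finite ?C" by (rule finite_UnionD) (simp only: un fin)
    show "(\<lambda>v. r `` {v}) ` (V - \<Union>M0) \<subseteq> ?C" by (auto intro: quotientI)
    show "inj_on (\<lambda>v. r `` {v}) (V - \<Union>M0)"
    proof
      fix a b assume ab: "a \<in> V - \<Union>M0" "b \<in> V - \<Union>M0" "r `` {a} = r `` {b}"
      then have "(a, b) \<in> r" using eq_equiv_class[OF ab(3) eq] by simp
      then show "a = b" using ab(1,2) M0 unfolding r_def by simp metis
    qed
  qed
  ultimately show ?thesis using un by metis
qed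

text \<open>If some vertex is covered by every maximum matching, delete it, apply induction and add
  it to \<open>T\<close>. That the blocks fill \<open>V - T\<close> is used later to locate the
  neighbours of the separating set.\<close>

lemma Tutte_Berge:
  assumes "finite V"
  shows "\<exists>T \<C> M. odd_blocks V T \<C> \<and> \<Union>\<C> = V - T \<and> matches V M \<and>
    card (V - \<Union>M) + card T \<le> card \<C>"
  using assms
proof (induction V rule: finite_psubset_induct)
  case (psubset V)
  show ?case
  proof (cases "\<forall>v\<in>V. \<exists>M. max_matching V M \<and> v \<notin> \<Union>M")
    case True
    obtain M0 where M0: "max_matching V M0" using ex_max_matching[OF psubset.hyps] by (rule exE)
    then obtain \<C> where "odd_blocks V {} \<C>" "\<Union>\<C> = V" "card (V - \<Union>M0) \<le> card \<C>"
      using Tutte_Berge_all_missed[OF psubset.hyps _ M0] True by metis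
    then show ?thesis using M0 unfolding max_matching_def by (intro exI[of _ "{}"] exI[of _ \<C>] exI[of _ M0]) simp
  next
    case False
    then obtain v where v: "v \<in> V" and cov: "\<And>M. max_matching V M \<Longrightarrow> v \<in> \<Union>M" by metis
    have "V - {v} \<subset> V" using v by auto
    from psubset.IH[OF this] obtain T \<C> M where
      ob: "odd_blocks (V - {v}) T \<C>" and un: "\<Union>\<C> = V - {v} - T" and M: "matches (V - {v}) M"
      and le: "card (V - {v} - \<Union>M) + card T \<le> card \<C>" by (elim exE conjE)
    obtain K where K: "max_matching V K" using ex_max_matching[OF psubset.hyps] by (rule exE)
    have MV: "matches V M" using matches_mono[OF M] by simp
    have vM: "v \<notin> \<Union>M" using matches_Union[OF M] by auto
    have "card M < card K"
    proof (rule ccontr)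
      assume "\<not> ?thesis"
      then have "max_matching V M" using K MV unfolding max_matching_def by (meson le_trans not_less)
      then show False using cov vM by metis
    qed
    moreover have mK: "matches V K" using K by (simp add: max_matching_def)
    moreover have "card (V - {v}) = card V - 1" "card V > 0" using v psubset.hyps by (auto simp: card_gt_0_iff)
    moreover have "finite (V - {v})" using psubset.hyps by simp
    \<comment> \<open>\<open>K\<close> has at least one edge more, covering two further vertices,
      while \<open>V\<close> has only one vertex more. The deficiency saved pays for
      \<open>v\<close> in \<open>T\<close>.\<close>
    ultimately have "Suc (card (V - \<Union>K)) \<le> card (V - {v} - \<Union>M)"
      using card_uncovered[OF psubset.hyps mK] card_uncovered[OF _ M] by simp
    moreover have T: "T \<subseteq> V - {v}" using ob by (simp add: odd_blocks_def)
    then have "card (insert v T) = Suc (card T)"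
      using psubset.hyps finite_subset[of T V] by (subst card_insert_disjoint) auto
    ultimately have "card (V - \<Union>K) + card (insert v T) \<le> card \<C>" using le by simp
    moreover have "\<Union>\<C> = V - insert v T" using un by auto
    moreover have "odd_blocks V (insert v T) \<C>"
    proof -
      have "e \<subseteq> C \<union> insert v T" if C: "C \<in> \<C>" and e: "e \<in> E" "e \<subseteq> V" "e \<inter> C \<noteq> {}" for C e
      proof (cases "v \<in> e")
        case True
        obtain w where w: "e = {v, w}" by (rule edge_other[OF e(1) True])
        have "v \<notin> C" using un C by auto
        then show ?thesis using w e(3) by auto
      next
        case False
        then have "e \<subseteq> V - {v}" using e(2) by auto
        then have "e \<subseteq> C \<union> T" using ob C e unfolding odd_blocks_def by simp
        then show ?thesis by auto
      qed
      then show ?thesis using ob v T \<open>\<Union>\<C> = V - insert v T\<close> unfolding odd_blocks_def by auto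
    qed
    ultimately show ?thesis using mK by metis
  qed
qed

section \<open>Deleting a set of \<open>n + 2\<close> vertices\<close>

text \<open>The bound 2 admits the three kinds of test made below: the empty matching, a single
  edge, and two disjoint edges.\<close>

definition two_extendable :: "nat \<Rightarrow> nat \<Rightarrow> 'a set \<Rightarrow> bool" where
  "two_extendable n d V \<longleftrightarrow> (\<forall>Y K. Y \<subseteq> V \<longrightarrow> card Y = n \<longrightarrow> matches (V - Y) K \<longrightarrow> card K \<le> 2 \<longrightarrow>
     (\<exists>K'. K \<subseteq> K' \<and> matches (V - Y) K' \<and> card (V - Y - \<Union>K') = d))"

lemma odd_blocks_disjoint:
  assumes "odd_blocks V T \<C>" "C \<in> \<C>" "D \<in> \<C>" "c \<in> C" "c \<in> D" shows "C = D"
  using assms unfolding odd_blocks_def disjoint_iff by metis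

lemma odd_blocks_notin:
  assumes "odd_blocks V T \<C>" "C \<in> \<C>" shows "C \<subseteq> V" "C \<inter> T = {}"
proof -
  have "C \<subseteq> V - T" using assms unfolding odd_blocks_def by (metis Union_upper subset_trans)
  then show "C \<subseteq> V" "C \<inter> T = {}" by auto
qed

text \<open>Blocks of odd remainder are nonempty after deleting \<open>D\<close>, so none are lost
  or identified, and the easy half applies to \<open>V - D\<close>.\<close>

lemma odd_blocks_Diff_le:
  assumes fin: "finite V" and ob: "odd_blocks V T \<C>" and M: "matches (V - D) M"
    and odd: "\<And>C. C \<in> \<C> \<Longrightarrow> odd (card (C - D))"
  shows "card \<C> \<le> card (V - D - \<Union>M) + card (T - D)"
proof -
  let ?h = "\<lambda>C. C - D"
  have ne: "\<exists>c. c \<in> C \<and> c \<notin> D" if "C \<in> \<C>" for C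
  proof -
    have "C - D \<noteq> {}" using odd[OF that] by (metis card.empty even_zero)
    then show ?thesis by auto
  qed
  have "inj_on ?h \<C>"
  proof
    fix A B assume AB: "A \<in> \<C>" "B \<in> \<C>" "A - D = B - D"
    obtain c where c: "c \<in> A" "c \<notin> D" using ne[OF AB(1)] by (elim exE conjE)
    then have "c \<in> B" using AB(3) by auto
    then show "A = B" by (rule odd_blocks_disjoint[OF ob AB(1,2) c(1)])
  qed
  then have "card \<C> = card (?h ` \<C>)" by (simp add: card_image)
  also have "\<dots> \<le> card (V - D - \<Union>M) + card (T - D)"
  proof (rule odd_blocks_le[OF _ _ M])
    show "finite (V - D)" using fin by simp
    have "T - D \<subseteq> V - D" using ob by (auto simp: odd_blocks_def)
    moreover have "\<Union>(?h ` \<C>) \<subseteq> (V - D) - (T - D)" using odd_blocks_notin[OF ob] by fastforce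
    moreover have "\<forall>A\<in>?h ` \<C>. \<forall>B\<in>?h ` \<C>. A \<noteq> B \<longrightarrow> A \<inter> B = {}"
      using odd_blocks_disjoint[OF ob] by fastforce
    moreover have "e \<subseteq> (C - D) \<union> (T - D)"
      if "C \<in> \<C>" "e \<in> E" "e \<subseteq> V - D" "e \<inter> (C - D) \<noteq> {}" for C e
    proof -
      have "e \<subseteq> V" "e \<inter> C \<noteq> {}" using that(3,4) by auto
      then have "e \<subseteq> C \<union> T" using ob that(1,2) unfolding odd_blocks_def by simp
      then show ?thesis using that(3) by auto
    qed
    ultimately show "odd_blocks (V - D) (T - D) (?h ` \<C>)" using odd unfolding odd_blocks_def by simp
  qed
  finally show ?thesis .
qed

text \<open>Delete \<open>n\<close> vertices of \<open>T\<close> off \<open>K\<close> and extend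
  \<open>K\<close>. The extension without \<open>K\<close> misses \<open>d\<close> of the remaining
  vertices, every block is still odd, and \<open>T\<close> has lost
  \<open>n + card (T \<inter> \<Union>K)\<close> vertices.\<close>

lemma two_extendable_odd_blocks_le:
  assumes fin: "finite V" and te: "two_extendable n d V" and ob: "odd_blocks V T \<C>"
    and K: "matches V K" "card K \<le> 2" and odd: "\<And>C. C \<in> \<C> \<Longrightarrow> odd (card (C - \<Union>K))"
    and big: "n + card (T \<inter> \<Union>K) \<le> card T"
  shows "card \<C> + n + card (T \<inter> \<Union>K) \<le> d + card T"
proof -
  have TV: "T \<subseteq> V" using ob by (simp add: odd_blocks_def)
  then have finT: "finite T" using fin by (rule finite_subset)
  have cT: "card (T - \<Union>K) + card (T \<inter> \<Union>K) = card T"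
    using card_Diff_subset_Int[of T "\<Union>K"] card_mono[OF finT Int_lower1, of "\<Union>K"] finT by simp
  then have "n \<le> card (T - \<Union>K)" using big by simp
  then obtain Y where Y: "Y \<subseteq> T - \<Union>K" "card Y = n" "finite Y" by (rule obtain_subset_with_card_n)
  have YV: "Y \<subseteq> V" using Y(1) TV by auto
  have "\<Union>K \<subseteq> V - Y" using matches_Union[OF K(1)] Y(1) by auto
  then have "matches (V - Y) K" by (rule matches_restrict[OF K(1)])
  then obtain K' where K': "K \<subseteq> K'" "matches (V - Y) K'" "card (V - Y - \<Union>K') = d"
    using te YV Y(2) K(2) unfolding two_extendable_def by metis
  let ?D = "Y \<union> \<Union>K"
  have UK: "\<Union>K' = \<Union>(K' - K) \<union> \<Union>K" using K'(1) by auto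
  have "\<Union>(K' - K) \<subseteq> V - ?D"
    using matches_Union[OF K'(2)] matches_Diff_disjoint[OF K'(2,1)] unfolding UK by auto
  then have M: "matches (V - ?D) (K' - K)"
    by (rule matches_restrict[OF matches_subset[OF K'(2) Diff_subset]])
  have "odd (card (C - ?D))" if C: "C \<in> \<C>" for C
  proof -
    have "C - ?D = C - \<Union>K" using odd_blocks_notin(2)[OF ob C] Y(1) by auto
    then show ?thesis using odd[OF C] by simp
  qed
  then have "card \<C> \<le> card (V - ?D - \<Union>(K' - K)) + card (T - ?D)"
    by (rule odd_blocks_Diff_le[OF fin ob M])
  moreover have "V - ?D - \<Union>(K' - K) = V - Y - \<Union>K'" unfolding UK by auto
  moreover have "T - ?D = (T - \<Union>K) - Y" by auto
  moreover have "card ((T - \<Union>K) - Y) = card (T - \<Union>K) - n" "n \<le> card (T - \<Union>K)"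
    using Y finT card_mono[of "T - \<Union>K" Y] by (simp_all add: card_Diff_subset)
  ultimately show ?thesis using K'(3) cT by simp
qed

section \<open>Contradiction from a tight configuration\<close>

lemma two_extendable_tight_False:
  assumes fin: "finite V" and te: "two_extendable n d V" and ob: "odd_blocks V X \<C>"
    and un: "\<Union>\<C> = V - X" and X: "n + 2 \<le> card X" and ge: "card X + d \<le> card \<C> + n" and nd: "d < n"
  shows False
proof -
  have XV: "X \<subseteq> V" using ob by (simp add: odd_blocks_def)
  then have finX: "finite X" using fin by (rule finite_subset)
  have oddC: "odd (card C)" if "C \<in> \<C>" for C using ob that by (simp add: odd_blocks_def)
  have "\<C> \<subseteq> Pow V" using odd_blocks_notin(1)[OF ob] by auto
  then have finC: "finite \<C>" using fin finite_subset by (metis finite_Pow_iff)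
  have le: "card \<C> + n \<le> card X + d"
    using two_extendable_odd_blocks_le[OF fin te ob matches_empty] oddC X by simp
  \<comment> \<open>By \<open>ge\<close> the bound \<open>le\<close> is attained, so covering two
    vertices of \<open>X\<close> without changing the parity of any block violates it by 2.\<close>
  have tight: False if "matches V K" "card K \<le> 2" "card (X \<inter> \<Union>K) = 2" "\<And>C. C \<in> \<C> \<Longrightarrow> odd (card (C - \<Union>K))" for K
    using two_extendable_odd_blocks_le[OF fin te ob that(1,2,4)] that(3) X ge by simp
  have indep: "{a, b} \<notin> E" if "a \<in> X" "b \<in> X" for a b
  proof
    assume e: "{a, b} \<in> E"
    have ab: "card {a, b} = 2" by (rule card_edge[OF e])
    show False
    proof (rule tight)
      show "matches V {{a, b}}" using e that XV by (auto simp: matches_def)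
      have "X \<inter> \<Union>{{a, b}} = {a, b}" using that by auto
      then show "card (X \<inter> \<Union>{{a, b}}) = 2" using ab by simp
      show "odd (card (C - \<Union>{{a, b}}))" if C: "C \<in> \<C>" for C
      proof -
        have "C - \<Union>{{a, b}} = C" using odd_blocks_notin(2)[OF ob C] \<open>a \<in> X\<close> \<open>b \<in> X\<close> by auto
        then show ?thesis using oddC[OF C] by simp
      qed
    qed simp
  qed
  \<comment> \<open>Two disjoint edges from \<open>X\<close> into one block remove two vertices from
    it, which preserves its parity; so any two such edges meet.\<close>
  have star: "i = i' \<or> c = c'"
    if C: "C \<in> \<C>" and i: "i \<in> X" "i' \<in> X" and c: "c \<in> C" "c' \<in> C" and e: "{i, c} \<in> E" "{i', c'} \<in> E"
    for C i i' c c'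
  proof (rule ccontr)
    assume "\<not> ?thesis"
    then have ne: "i \<noteq> i'" "c \<noteq> c'" by simp_all
    have CX: "C \<inter> X = {}" and CV: "C \<subseteq> V" using odd_blocks_notin[OF ob C] by simp_all
    then have cX: "c \<notin> X" "c' \<notin> X" using c by auto
    let ?K = "{{i, c}, {i', c'}}"
    have UK: "\<Union>?K = {i, i', c, c'}" by auto
    show False
    proof (rule tight)
      have "{i, c} \<inter> {i', c'} = {}" using ne cX i by auto
      moreover have "{i, c} \<subseteq> V" "{i', c'} \<subseteq> V" using i c XV CV by auto
      ultimately show "matches V ?K" using e by (auto simp: matches_def)
      show "card ?K \<le> 2" by (simp add: card_insert_if)
      have "X \<inter> \<Union>?K = {i, i'}" using i cX by auto
      then show "card (X \<inter> \<Union>?K) = 2" using ne(1) by simp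
      show "odd (card (D - \<Union>?K))" if D: "D \<in> \<C>" for D
      proof (cases "D = C")
        case True
        have finC: "finite C" using CV fin by (rule finite_subset)
        have "D - \<Union>?K = C - {c, c'}" unfolding UK True using CX i by auto
        moreover have "card (C - {c, c'}) = card C - 2"
          using c ne(2) by (subst card_Diff_subset) auto
        moreover have "2 \<le> card C" using card_mono[OF finC, of "{c, c'}"] c ne(2) by simp
        ultimately show ?thesis using oddC[OF C] by simp
      next
        case False
        then have "c \<notin> D" "c' \<notin> D" using odd_blocks_disjoint[OF ob D C] c by metis+
        moreover have "D \<inter> X = {}" by (rule odd_blocks_notin(2)[OF ob D])
        ultimately have "D - \<Union>?K = D" unfolding UK using i by auto
        then show ?thesis using oddC[OF D] by simp
      qed
    qed
  qed
  \<comment> \<open>The edges between \<open>X\<close> and a block form a star; deleting all centres leaves too many odd blocks.\<close>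
  have "\<exists>z. z \<in> C \<union> X \<and> (\<forall>i\<in>X. \<forall>c\<in>C. {i, c} \<in> E \<longrightarrow> z = i \<or> z = c)" if C: "C \<in> \<C>" for C
  proof (cases "\<exists>i\<in>X. \<exists>c\<in>C. {i, c} \<in> E")
    case False
    have "C \<noteq> {}" using oddC[OF C] by (metis card.empty even_zero)
    then show ?thesis using False by auto
  next
    case True
    then obtain i c where ic: "i \<in> X" "c \<in> C" "{i, c} \<in> E" by (elim bexE)
    show ?thesis
    proof (cases "\<forall>i'\<in>X. \<forall>c'\<in>C. {i', c'} \<in> E \<longrightarrow> c = c'")
      case True
      then show ?thesis using ic(2) by (intro exI[of _ c]) simp
    next
      case False
      then obtain i' c' where ic': "i' \<in> X" "c' \<in> C" "{i', c'} \<in> E" "c \<noteq> c'" by metis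
      then have "i' = i" using star[OF C ic(1) ic'(1) ic(2) ic'(2) ic(3) ic'(3)] by simp
      \<comment> \<open>An edge avoiding \<open>i\<close> would have to end in both \<open>c\<close>
        and \<open>c'\<close>.\<close>
      have "i = j" if "j \<in> X" "b \<in> C" "{j, b} \<in> E" for j b
        using star[OF C ic(1) that(1) ic(2) that(2) ic(3) that(3)]
          star[OF C ic'(1) that(1) ic'(2) that(2) ic'(3) that(3)] ic'(4) \<open>i' = i\<close> by metis
      then show ?thesis using ic(1) by (intro exI[of _ i]) simp
    qed
  qed
  then obtain z where z: "\<And>C. C \<in> \<C> \<Longrightarrow> z C \<in> C \<union> X"
    and cen: "\<And>C i c. C \<in> \<C> \<Longrightarrow> i \<in> X \<Longrightarrow> c \<in> C \<Longrightarrow> {i, c} \<in> E \<Longrightarrow> z C = i \<or> z C = c" by metis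
  define A B where "A = {C \<in> \<C>. z C \<in> X}" and "B = {C \<in> \<C>. z C \<in> C}"
  have disjCX: "c \<notin> X" if "C \<in> \<C>" "c \<in> C" for C c using odd_blocks_notin(2)[OF ob that(1)] that(2) by auto
  have AB: "card A + card B = card \<C>"
  proof -
    have "A \<inter> B = {}" using disjCX unfolding A_def B_def by auto
    moreover have "A \<union> B = \<C>" using z unfolding A_def B_def by auto
    moreover have "finite A" "finite B" using finC unfolding A_def B_def by simp_all
    ultimately show ?thesis using card_Un_disjoint by metis
  qed
  define Z where "Z = z ` \<C>"
  have ZV: "Z \<subseteq> V" using z odd_blocks_notin(1)[OF ob] XV unfolding Z_def by fastforce
  have finZ: "finite Z" unfolding Z_def using finC by simp
  have ZX: "Z \<inter> X = z ` A" unfolding Z_def A_def by auto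
  \<comment> \<open>Only an inequality here: blocks of \<open>A\<close> may share a centre in
    \<open>X\<close>, whereas those of \<open>B\<close> have centres in disjoint blocks.\<close>
  have cardZX: "card (Z \<inter> X) \<le> card A"
    unfolding ZX by (rule card_image_le) (simp add: A_def finC)
  have ZB: "Z - X = z ` B" using z disjCX unfolding Z_def B_def by fastforce
  have cardZB: "card (Z - X) = card B"
    unfolding ZB
  proof (rule card_image, rule inj_onI)
    fix C D assume "C \<in> B" "D \<in> B" "z C = z D"
    then show "C = D" using odd_blocks_disjoint[OF ob, of C D "z C"] by (simp add: B_def)
  qed
  have main: "card X + card A + n \<le> d + card B + 2 * card (Z' \<inter> X)"
    if Z': "Z \<subseteq> Z'" "Z' \<subseteq> Z \<union> X" "n \<le> card Z'" for Z'
  proof -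
    \<comment> \<open>Deleting \<open>Z'\<close> isolates the rest of \<open>X\<close> and keeps the blocks with centre in \<open>X\<close> intact.\<close>
    let ?S = "(\<lambda>x. {x}) ` (X - Z')"
    have ZV': "Z' \<subseteq> V" using Z' ZV XV by auto
    have finZ': "finite Z'" using ZV' fin by (rule finite_subset)
    have ZB': "Z' - X = Z - X" using Z' by auto
    have "odd_blocks V Z' (?S \<union> A)"
    proof -
      have AC: "C \<in> \<C>" "z C \<in> X" if "C \<in> A" for C using that by (simp_all add: A_def)
      have AZ: "c \<notin> Z'" if C: "C \<in> A" "c \<in> C" for C c
      proof
        assume "c \<in> Z'"
        \<comment> \<open>Outside \<open>X\<close>, the set \<open>Z'\<close> consists of centres of
          blocks in \<open>B\<close>.\<close>
        then have "c \<in> z ` B" using disjCX[OF AC(1)[OF C(1)] C(2)] ZB' ZB by auto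
        then obtain D where D: "D \<in> \<C>" "z D \<in> D" "c = z D" by (auto simp: B_def)
        then have "C = D" using odd_blocks_disjoint[OF ob AC(1)[OF C(1)] D(1) C(2)] by simp
        then show False using disjCX[OF D(1,2)] AC(2)[OF C(1)] by simp
      qed
      have o1: "\<Union>(?S \<union> A) \<subseteq> V - Z'" using XV AZ odd_blocks_notin(1)[OF ob AC(1)] by fastforce
      have o2: "\<forall>C\<in>?S \<union> A. \<forall>D\<in>?S \<union> A. C \<noteq> D \<longrightarrow> C \<inter> D = {}"
        using disjCX[OF AC(1)] odd_blocks_disjoint[OF ob AC(1) AC(1)] by fastforce
      have o3: "\<forall>C\<in>?S \<union> A. odd (card C)" using oddC[OF AC(1)] by auto
      have singleton: "e \<subseteq> {x} \<union> Z'" if x: "x \<in> X" "x \<notin> Z'" and e: "e \<in> E" "e \<subseteq> V" "x \<in> e" for x e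
      proof -
        obtain y where y: "e = {x, y}" by (rule edge_other[OF e(1,3)])
        \<comment> \<open>By independence \<open>y\<close> lies in a block, whose centre is
          \<open>x\<close> or \<open>y\<close>. As \<open>x\<close> is not in \<open>Z'\<close>, the
          centre is \<open>y\<close>.\<close>
        have "y \<notin> X" using indep[OF x(1)] e(1) y by metis
        then have "y \<in> \<Union>\<C>" using e(2) y un by simp
        then obtain C where C: "C \<in> \<C>" "y \<in> C" by (rule UnionE)
        have zC: "z C \<in> Z'" using Z'(1) C(1) by (auto simp: Z_def)
        then have "z C = y" using cen[OF C(1) x(1) C(2)] e(1) y x(2) by metis
        then show ?thesis using y zC by auto
      qed
      have block: "e \<subseteq> C \<union> Z'" if C: "C \<in> A" and e: "e \<in> E" "e \<subseteq> V" "e \<inter> C \<noteq> {}" for C e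
      proof -
        have CC: "C \<in> \<C>" "z C \<in> X" using AC[OF C] by simp_all
        obtain c where c: "c \<in> e" "c \<in> C" using e(3) by auto
        obtain y where y: "e = {c, y}" by (rule edge_other[OF e(1) c(1)])
        have "e \<subseteq> C \<union> X" using ob CC(1) e unfolding odd_blocks_def by simp
        then have "y \<in> C \<or> y \<in> X" using y by simp
        moreover have "y \<in> Z'" if yX: "y \<in> X"
        proof -
          have "z C = y \<or> z C = c" using cen[OF CC(1) yX c(2)] e(1) y by (simp add: insert_commute)
          then have "z C = y" using CC(2) disjCX[OF CC(1) c(2)] by metis
          then show ?thesis using Z'(1) CC(1) by (auto simp: Z_def)
        qed
        ultimately show ?thesis using y c(2) by auto
      qed
      have "e \<subseteq> C \<union> Z'" if C: "C \<in> ?S \<union> A" and e: "e \<in> E" "e \<subseteq> V" "e \<inter> C \<noteq> {}" for C e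
      proof (cases "C \<in> A")
        case True
        then show ?thesis by (rule block[OF _ e])
      next
        case False
        then obtain x where x: "x \<in> X" "x \<notin> Z'" "C = {x}" using C by auto
        then show ?thesis using singleton[OF x(1,2) e(1,2)] e(3) by simp
      qed
      then have o4: "\<forall>C\<in>?S \<union> A. \<forall>e\<in>E. e \<subseteq> V \<longrightarrow> e \<inter> C \<noteq> {} \<longrightarrow> e \<subseteq> C \<union> Z'" by simp
      show ?thesis unfolding odd_blocks_def by (intro conjI ZV' o1 o2 o3 o4)
    qed
    note ob' = this
    have "card (?S \<union> A) + n \<le> d + card Z'"
      using two_extendable_odd_blocks_le[OF fin te ob' matches_empty] Z'(3) ob'
      by (simp add: odd_blocks_def)
    moreover have "card (?S \<union> A) = card (X - Z') + card A"
    proof -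
      have "?S \<inter> A = {}" using disjCX unfolding A_def by auto
      moreover have "card ?S = card (X - Z')" by (rule card_image) simp
      moreover have "finite ?S" "finite A" using finX finC by (simp_all add: A_def)
      ultimately show ?thesis by (simp add: card_Un_disjoint)
    qed
    moreover have "card (X - Z') + card (Z' \<inter> X) = card X"
      using card_Diff_subset_Int[of X Z'] card_mono[OF finX, of "X \<inter> Z'"] finX by (simp add: Int_commute)
    moreover have "card Z' = card B + card (Z' \<inter> X)"
      using card_Diff_subset_Int[of Z' X] card_mono[OF finZ', of "Z' \<inter> X"] finZ' cardZB ZB' by simp
    ultimately show ?thesis by simp
  qed
  have cardZ: "card Z = card B + card (Z \<inter> X)"
    using card_Diff_subset_Int[of Z X] card_mono[OF finZ, of "Z \<inter> X"] finZ cardZB by simp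
  show False
  proof (cases "n \<le> card Z")
    case True
    \<comment> \<open>Since \<open>card (Z \<inter> X) \<le> card A\<close>, this gives
      \<open>card X + n \<le> d + card \<C>\<close>, and with \<open>le\<close> it follows that
      \<open>n \<le> d\<close>.\<close>
    have "card X + card A + n \<le> d + card B + 2 * card (Z \<inter> X)" using True by (intro main) auto
    then show False using cardZX AB le nd by simp
  next
    case False
    \<comment> \<open>With too few centres, \<open>Z\<close> is padded from \<open>X\<close> to
      exactly \<open>n\<close> vertices. The padded set meets \<open>X\<close> in
      \<open>n - card B\<close> vertices, and \<open>ge\<close> then forces
      \<open>card X \<le> n\<close>.\<close>
    have "card X \<le> card Z + card (X - Z)"
      using card_mono[of "Z \<union> (X - Z)" X] card_Un_le[of Z "X - Z"] finZ finX by force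
    then have "n - card Z \<le> card (X - Z)" using X by simp
    then obtain P where P: "P \<subseteq> X - Z" "card P = n - card Z" "finite P" by (rule obtain_subset_with_card_n)
    have "Z \<inter> P = {}" using P(1) by auto
    then have cn: "card (Z \<union> P) = n" using P(2,3) finZ False by (simp add: card_Un_disjoint)
    then have "card X + card A + n \<le> d + card B + 2 * card ((Z \<union> P) \<inter> X)"
      using P(1) by (intro main) auto
    moreover have "(Z \<union> P) \<inter> X = (Z \<inter> X) \<union> P" using P(1) by auto
    moreover have "card ((Z \<inter> X) \<union> P) = card (Z \<inter> X) + card P"
      using P(3) finZ \<open>Z \<inter> P = {}\<close> by (intro card_Un_disjoint) auto
    ultimately show False using P(2) cardZ AB ge X False by simp
  qed
qed

lemma two_extendable_delete:
  assumes fin: "finite V" and te: "two_extendable n d V" and I: "I \<subseteq> V" "card I = n + 2"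
    and nd: "d < n" and par: "even (card V + n + d)"
  shows "\<exists>M. matches (V - I) M \<and> card (V - I - \<Union>M) \<le> d"
proof (rule ccontr)
  assume no: "\<not> ?thesis"
  let ?Q = "V - I"
  have finQ: "finite ?Q" using fin by simp
  obtain T \<C> M where ob: "odd_blocks ?Q T \<C>" and un: "\<Union>\<C> = ?Q - T" and M: "matches ?Q M"
    and ge: "card (?Q - \<Union>M) + card T \<le> card \<C>" using Tutte_Berge[OF finQ] by (elim exE conjE)
  have finI: "finite I" using I(1) fin by (rule finite_subset)
  have "card ?Q + (n + 2) = card V"
    using card_Diff_subset[OF finI I(1)] card_mono[OF fin I(1)] I(2) by simp
  then have "even (card (?Q - \<Union>M) + d)" using card_uncovered[OF finQ M] par by presburger
  moreover have "d < card (?Q - \<Union>M)" using no M by (simp add: not_le[symmetric])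
  \<comment> \<open>Parity lifts the deficiency from \<open>d + 1\<close> to \<open>d + 2\<close>;
    the extra 2 offsets the two vertices of \<open>I\<close> beyond \<open>n\<close>.\<close>
  ultimately have "d + 2 \<le> card (?Q - \<Union>M)" by presburger
  let ?X = "T \<union> I"
  have T: "T \<subseteq> ?Q" using ob by (simp add: odd_blocks_def)
  have "card ?X = card T + card I"
    using T finI finite_subset[OF T finQ] by (intro card_Un_disjoint) auto
  then have cX: "card ?X = card T + n + 2" using I(2) by simp
  have un': "\<Union>\<C> = V - ?X" unfolding un by auto
  have "e \<subseteq> C \<union> ?X" if C: "C \<in> \<C>" and e: "e \<in> E" "e \<subseteq> V" "e \<inter> C \<noteq> {}" for C e
  proof -
    obtain c where c: "c \<in> e" "c \<in> C" using e(3) by auto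
    obtain y where y: "e = {c, y}" by (rule edge_other[OF e(1) c(1)])
    have "e \<subseteq> ?Q" if "y \<notin> I" using odd_blocks_notin(1)[OF ob C] c(2) y e(2) that by auto
    then have "e \<subseteq> C \<union> T" if "y \<notin> I" using ob C e that unfolding odd_blocks_def by simp
    then show ?thesis using y c(2) by auto
  qed
  then have "odd_blocks V ?X \<C>" using ob I(1) T un' unfolding odd_blocks_def by auto
  then show False
    by (rule two_extendable_tight_False[OF fin te _ un' _ _ nd])
      (use cX ge \<open>d + 2 \<le> card (?Q - \<Union>M)\<close> in simp_all)
qed

section \<open>Assembling the extension\<close>

text \<open>Dropping an edge uncovers two vertices, so by parity the deficiency can be raised to
  exactly \<open>d\<close>.\<close>

lemma matching_drop_edges:
  assumes fin: "finite W" and M: "matches W M" and le: "card (W - \<Union>M) \<le> d" "d \<le> card W"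
    and par: "even (card W + d)"
  shows "\<exists>N\<subseteq>M. card (W - \<Union>N) = d"
proof -
  have "(card W - d) div 2 \<le> card M" using card_uncovered[OF fin M] le by simp
  then obtain N where N: "N \<subseteq> M" "card N = (card W - d) div 2" by (rule obtain_subset_with_card_n)
  have "even (card W - d)" using par le(2) by simp
  then have "2 * card N = card W - d" unfolding N(2) by simp
  then have "card (W - \<Union>N) = d" using card_uncovered[OF fin matches_subset[OF M N(1)]] le(2) by simp
  then show ?thesis using N(1) by metis
qed

text \<open>Adding at most two edges to \<open>M0\<close> stays within \<open>k\<close> edges, so
  \<open>extendable_le\<close> applies; taking \<open>M0\<close> out of the extension leaves a
  matching of the smaller set.\<close>

lemma two_extendable_minus_matching:
  assumes fin: "finite V" and ext: "\<And>Y. Y \<subseteq> V \<Longrightarrow> card Y = n \<Longrightarrow> extendable k d (V - Y)"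
    and big: "n + 2 * k + d < card V" and M0: "matches V M0" "card M0 + 2 \<le> k"
  shows "two_extendable n d (V - \<Union>M0)"
  unfolding two_extendable_def
proof (intro allI impI)
  fix Y K assume Y: "Y \<subseteq> V - \<Union>M0" "card Y = n" and K: "matches (V - \<Union>M0 - Y) K" "card K \<le> 2"
  have YV: "Y \<subseteq> V" using Y(1) by auto
  have finVY: "finite (V - Y)" using fin by simp
  have "card V = card (V - Y) + n"
    using card_Diff_subset[OF finite_subset[OF YV fin] YV] card_mono[OF fin YV] Y(2) by simp
  then have big': "2 * k + d < card (V - Y)" using big by simp
  have "\<Union>M0 \<subseteq> V - Y" using matches_Union[OF M0(1)] Y(1) by auto
  then have M0': "matches (V - Y) M0" by (rule matches_restrict[OF M0(1)])
  have UK: "\<Union>K \<subseteq> V - \<Union>M0 - Y" by (rule matches_Union[OF K(1)])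
  then have "\<Union>M0 \<inter> \<Union>K = {}" by auto
  then have "matches ((V - Y) \<union> (V - \<Union>M0 - Y)) (M0 \<union> K)" by (rule matches_Un[OF M0' K(1)])
  moreover have "(V - Y) \<union> (V - \<Union>M0 - Y) = V - Y" by auto
  ultimately have MK: "matches (V - Y) (M0 \<union> K)" by simp
  have "card (M0 \<union> K) \<le> k" using card_Un_le[of M0 K] M0(2) K(2) by simp
  then have "extendable (card (M0 \<union> K)) d (V - Y)"
    by (rule extendable_le[OF finVY big' _ ext[OF YV Y(2)]])
  then obtain N where N: "M0 \<union> K \<subseteq> N" "matches (V - Y) N" "card (V - Y - \<Union>N) = d"
    using MK unfolding extendable_def by metis
  have M0N: "M0 \<subseteq> N" using N(1) by simp
  have UN: "\<Union>N = \<Union>(N - M0) \<union> \<Union>M0" using M0N by auto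
  have dis: "\<Union>(N - M0) \<inter> \<Union>M0 = {}" by (rule matches_Diff_disjoint[OF N(2) M0N])
  show "\<exists>K'. K \<subseteq> K' \<and> matches (V - \<Union>M0 - Y) K' \<and> card (V - \<Union>M0 - Y - \<Union>K') = d"
  proof (intro exI[of _ "N - M0"] conjI)
    show "K \<subseteq> N - M0"
    proof
      fix e assume e: "e \<in> K"
      have "e \<noteq> {}" using card_edge[of e] matches_edge[OF K(1) e] by auto
      then have "e \<notin> M0" using UK e by auto
      then show "e \<in> N - M0" using N(1) e by auto
    qed
    have "\<Union>(N - M0) \<subseteq> V - \<Union>M0 - Y" using matches_Union[OF N(2)] dis unfolding UN by auto
    then show "matches (V - \<Union>M0 - Y) (N - M0)"
      by (rule matches_restrict[OF matches_subset[OF N(2) Diff_subset]])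
    have "V - \<Union>M0 - Y - \<Union>(N - M0) = V - Y - \<Union>N" unfolding UN by auto
    then show "card (V - \<Union>M0 - Y - \<Union>(N - M0)) = d" using N(3) by simp
  qed
qed

text \<open>Serves the case of \<open>x\<close> matched to \<open>v\<close>: \<open>I\<close> is the
  deleted set with \<open>v\<close>, and \<open>M0\<close> is the given matching without the edge at
  \<open>x\<close>, hence \<open>card M0 + 2 = k\<close>. A matching off \<open>I\<close> and
  \<open>M0\<close> is trimmed to defect \<open>d\<close> and joined to \<open>M0\<close>.\<close>

lemma extend_avoiding:
  assumes fin: "finite V" and ext: "\<And>Y. Y \<subseteq> V \<Longrightarrow> card Y = n \<Longrightarrow> extendable k d (V - Y)"
    and big: "n + 2 * k + d + 2 \<le> card V" and par: "even (card V + n + d)" and nd: "d < n"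
    and I: "I \<subseteq> V" "card I = n + 2" and M0: "matches (V - I) M0" "card M0 + 2 = k"
  shows "\<exists>M'. M0 \<subseteq> M' \<and> matches (V - I) M' \<and> card (V - I - \<Union>M') = d"
proof -
  let ?V0 = "V - \<Union>M0" let ?W = "V - \<Union>M0 - I"
  have M0V: "matches V M0" by (rule matches_mono[OF M0(1) Diff_subset])
  have "two_extendable n d ?V0"
    by (rule two_extendable_minus_matching[OF fin ext _ M0V]) (use big M0(2) in simp_all)
  moreover have I0: "I \<subseteq> ?V0" using I(1) matches_Union[OF M0(1)] by auto
  moreover have cV0: "card ?V0 + 2 * card M0 = card V" by (rule card_uncovered[OF fin M0V])
  then have "even (card ?V0 + n + d)" using par by presburger
  ultimately obtain K where K: "matches ?W K" "card (?W - \<Union>K) \<le> d"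
    using two_extendable_delete[of ?V0 n d I] fin I(2) nd by auto
  have "card ?V0 = card ?W + (n + 2)"
    using card_Diff_subset[OF finite_subset[OF I(1) fin] I0] card_mono[OF _ I0] fin I(2) by simp
  then have "d \<le> card ?W" "even (card ?W + d)" using cV0 big M0(2) par by (simp, presburger)
  then obtain N where N: "N \<subseteq> K" "card (?W - \<Union>N) = d"
    using matching_drop_edges[OF _ K] fin by auto
  have mN: "matches ?W N" by (rule matches_subset[OF K(1) N(1)])
  have "\<Union>M0 \<inter> \<Union>N = {}" using matches_Union[OF mN] by auto
  then have "matches ((V - I) \<union> ?W) (M0 \<union> N)" by (rule matches_Un[OF M0(1) mN])
  moreover have "(V - I) \<union> ?W = V - I" by auto
  moreover have "V - I - \<Union>(M0 \<union> N) = ?W - \<Union>N" by auto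
  ultimately show ?thesis using N(2) by (intro exI[of _ "M0 \<union> N"]) simp
qed

end

section \<open>Adding a vertex\<close>

lemma edge_set_edges: "simple_graph G \<Longrightarrow> edge_set (edges G)"
  by unfold_locales (simp add: simple_graph_def)

lemma matching_delete_verts:
  assumes "simple_graph G"
  shows "matching (delete_verts G S) M \<longleftrightarrow> edge_set.matches (edges G) (verts G - S) M"
proof -
  interpret edge_set "edges G" by (rule edge_set_edges[OF assms])
  have "M \<subseteq> {e \<in> edges G. e \<inter> S = {}} \<longleftrightarrow> M \<subseteq> edges G \<and> \<Union>M \<subseteq> verts G - S"
    using assms unfolding simple_graph_def by fastforce
  then show ?thesis by (simp add: matching_def matches_def delete_verts_def)
qed

text \<open>Passage to the locale: the defect becomes the number of uncovered vertices, and the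
  parity of a truncated difference becomes that of a sum.\<close>

lemma nkd_graph_iff:
  assumes G: "simple_graph G"
  shows "nkd_graph n k d G \<longleftrightarrow> n + 2 * k + d + 2 \<le> card (verts G) \<and> even (card (verts G) + n + d) \<and>
    (\<forall>S. S \<subseteq> verts G \<and> card S = n \<longrightarrow> edge_set.extendable (edges G) k d (verts G - S))"
proof -
  interpret edge_set "edges G" by (rule edge_set_edges[OF G])
  have fin: "finite (verts G)" using G by (simp add: simple_graph_def)
  have "defect_matching d (delete_verts G S) M \<longleftrightarrow>
      matches (verts G - S) M \<and> card (verts G - S - \<Union>M) = d" for S M
  proof -
    have "card (\<Union>M) + d = card (verts G - S) \<longleftrightarrow> card (verts G - S - \<Union>M) = d"
      if "matches (verts G - S) M"
      using card_uncovered[OF _ that] card_Union_matches[OF that] fin by auto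
    then show ?thesis unfolding defect_matching_def matching_delete_verts[OF G]
      by (auto simp: delete_verts_def)
  qed
  then have "(\<exists>M. k_matching k (delete_verts G S) M) \<and> (\<forall>M. k_matching k (delete_verts G S) M \<longrightarrow>
      (\<exists>M'. M \<subseteq> M' \<and> defect_matching d (delete_verts G S) M')) \<longleftrightarrow> extendable k d (verts G - S)" for S
    by (simp add: extendable_def k_matching_def matching_delete_verts[OF G])
  moreover have "even (card (verts G) - n - d) \<longleftrightarrow> even (card (verts G) + n + d)"
    if "n + 2 * k + d + 2 \<le> card (verts G)"
    using that by presburger
  ultimately show ?thesis unfolding nkd_graph_def using G by auto
qed

lemma simple_graph_add_vertex:
  assumes "simple_graph G" "x \<notin> verts G" shows "simple_graph (add_vertex G x)"
  using assms by (auto simp: simple_graph_def add_vertex_def card_insert_if)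

lemma matches_add_vertex:
  assumes "simple_graph G" "x \<notin> verts G" "x \<notin> W" "W \<subseteq> insert x (verts G)"
  shows "edge_set.matches (edges (add_vertex G x)) W M \<longleftrightarrow> edge_set.matches (edges G) W M"
proof -
  interpret G: edge_set "edges G" by (rule edge_set_edges[OF assms(1)])
  interpret H: edge_set "edges (add_vertex G x)"
    by (rule edge_set_edges[OF simple_graph_add_vertex[OF assms(1,2)]])
  have "M \<subseteq> edges (add_vertex G x) \<longleftrightarrow> M \<subseteq> edges G" if "\<Union>M \<subseteq> W"
  proof -
    have "x \<notin> e" if "e \<in> M" for e using that \<open>\<Union>M \<subseteq> W\<close> assms(3) by auto
    then show ?thesis by (fastforce simp: add_vertex_def)
  qed
  then show ?thesis unfolding G.matches_def H.matches_def by auto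
qed

text \<open>As \<open>x\<close> is adjacent to all of \<open>G\<close>, it can take over the partner
  of \<open>s\<close>; all other edges stay.\<close>

lemma matches_replace_vertex:
  assumes G: "simple_graph G" "x \<notin> verts G" and W: "W \<subseteq> verts G" "s \<in> verts G" "s \<notin> W"
    and K: "edge_set.matches (edges G) (insert s W) K"
  shows "\<exists>K'. edge_set.matches (edges (add_vertex G x)) (insert x W) K' \<and> card K' = card K \<and>
    {e \<in> K. s \<notin> e} \<subseteq> K'"
proof -
  interpret G: edge_set "edges G" by (rule edge_set_edges[OF G(1)])
  interpret H: edge_set "edges (add_vertex G x)"
    by (rule edge_set_edges[OF simple_graph_add_vertex[OF G]])
  have fin: "finite W" using G(1) W(1) finite_subset by (auto simp: simple_graph_def)
  have x: "x \<notin> insert s W" using G(2) W by auto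
  have HK: "H.matches (insert s W) K"
    using K matches_add_vertex[OF G x] W by auto
  show ?thesis
  proof (cases "s \<in> \<Union>K")
    case False
    then have "\<Union>K \<subseteq> insert x W" using G.matches_Union[OF K] by auto
    then have "H.matches (insert x W) K" by (rule H.matches_restrict[OF HK])
    then show ?thesis by (intro exI[of _ K]) simp
  next
    case True
    then obtain f where f: "f \<in> K" "s \<in> f" by (rule UnionE)
    have fE: "f \<in> edges G" "f \<subseteq> insert s W" using G.matches_edge[OF K f(1)] by simp_all
    obtain w where w: "f = {s, w}" "w \<noteq> s" by (rule G.edge_other[OF fE(1) f(2)])
    have wW: "w \<in> W" using w fE(2) by simp
    let ?K = "insert {x, w} (K - {f})"
    have s: "s \<notin> \<Union>(K - {f})" using G.matches_disjoint[OF K _ f(1) _ f(2)] by auto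
    \<comment> \<open>The exchange takes place in a set containing both \<open>x\<close> and
      \<open>s\<close>; afterwards \<open>s\<close> is uncovered and can be removed.\<close>
    have HK': "H.matches (insert x (insert s W)) K" by (rule H.matches_mono[OF HK]) auto
    have "x \<notin> \<Union>K" using G.matches_Union[OF K] x by auto
    moreover have "{x, w} \<in> edges (add_vertex G x)" using wW W(1) by (auto simp: add_vertex_def)
    ultimately have sw: "H.matches (insert x (insert s W)) ?K" "card ?K = card K"
      using H.matches_swap[OF _ HK', of x w f] fin wW f(1) w(1) by simp_all
    have "s \<notin> \<Union>?K" using s w(2) W(2) G(2) by auto
    then have "\<Union>?K \<subseteq> insert x W" using H.matches_Union[OF sw(1)] by auto
    then have "H.matches (insert x W) ?K" by (rule H.matches_restrict[OF sw(1)])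
    moreover have "{e \<in> K. s \<notin> e} \<subseteq> ?K" using f(2) by auto
    ultimately show ?thesis using sw(2) by (intro exI[of _ ?K]) simp
  qed
qed

theorem theorem3p1:
  fixes n k d :: nat and G :: "'a ugraph" and x :: 'a
  assumes "k > 0" and "n > d"
    and "nkd_graph n k d G"
    and "x \<notin> verts G"
  shows "nkd_graph (n + 1) (k - 1) d (add_vertex G x)"
proof -
  let ?V = "verts G" and ?H = "add_vertex G x"
  have G: "simple_graph G" using assms(3) by (simp add: nkd_graph_def)
  have H: "simple_graph ?H" by (rule simple_graph_add_vertex[OF G assms(4)])
  interpret G: edge_set "edges G" by (rule edge_set_edges[OF G])
  interpret H: edge_set "edges ?H" by (rule edge_set_edges[OF H])
  have fin: "finite ?V" using G by (simp add: simple_graph_def)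
  have vH: "verts ?H = insert x ?V" by (simp add: add_vertex_def)
  have cH: "card (insert x ?V) = Suc (card ?V)" using fin assms(4) by simp
  have big: "n + 2 * k + d + 2 \<le> card ?V" and par: "even (card ?V + n + d)"
    and ext: "\<And>S. S \<subseteq> ?V \<Longrightarrow> card S = n \<Longrightarrow> G.extendable k d (?V - S)"
    using assms(3) unfolding nkd_graph_iff[OF G] by simp_all
  \<comment> \<open>This serves the cases in which \<open>x\<close> is deleted or unmatched, and the
    existence of a \<open>(k - 1)\<close>-matching.\<close>
  have ext': "G.extendable (k - 1) d (?V - S)" if S: "S \<subseteq> ?V" "card S = n" for S
  proof (rule G.extendable_le[OF _ _ _ ext[OF S]])
    show "2 * k + d < card (?V - S)"
      using card_Diff_subset[OF finite_subset[OF S(1) fin] S(1)] S(2) big by simp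
  qed (use fin in simp_all)
  have "H.extendable (k - 1) d (insert x ?V - S)" if S: "S \<subseteq> insert x ?V" "card S = n + 1" for S
  proof (cases "x \<in> S")
    case True
    have "S - {x} \<subseteq> ?V" "card (S - {x}) = n" using S True by auto
    moreover have "insert x ?V - S = ?V - (S - {x})" using True assms(4) by auto
    ultimately have "G.extendable (k - 1) d (insert x ?V - S)" using ext' by simp
    moreover have "H.matches (insert x ?V - S) M \<longleftrightarrow> G.matches (insert x ?V - S) M" for M
      using True by (intro matches_add_vertex[OF G assms(4)]) auto
    ultimately show ?thesis by (simp add: G.extendable_def H.extendable_def)
  next
    case False
    let ?W = "?V - S"
    have SV: "S \<subseteq> ?V" using S(1) False by auto
    have finW: "finite ?W" "finite S" using fin SV finite_subset by auto
    have xW: "insert x ?V - S = insert x ?W" using False by auto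
    obtain s where s: "s \<in> S" using S(2) by fastforce
    have sV: "s \<in> ?V" and sW: "s \<notin> ?W" using s SV by auto
    have "S - {s} \<subseteq> ?V" "card (S - {s}) = n" using SV S(2) s finW by auto
    moreover have "?V - (S - {s}) = insert s ?W" using sV s by auto
    ultimately have ext_s: "G.extendable (k - 1) d (insert s ?W)" using ext' by metis
    note replace = matches_replace_vertex[OF G assms(4) Diff_subset sV sW]
    have "\<exists>M'. M \<subseteq> M' \<and> H.matches (insert x ?W) M' \<and> card (insert x ?W - \<Union>M') = d"
      if M: "H.matches (insert x ?W) M" "card M = k - 1" for M
    proof (cases "x \<in> \<Union>M")
      case False
      \<comment> \<open>Extend \<open>M\<close> with \<open>s\<close> in place of \<open>x\<close>,
        then change back. The edges of \<open>M\<close> avoid \<open>s\<close> and survive, and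
        equal edge counts preserve the defect.\<close>
      then have "\<Union>M \<subseteq> ?W" using H.matches_Union[OF M(1)] by auto
      then have "H.matches ?W M" by (rule H.matches_restrict[OF M(1)])
      then have MW: "G.matches ?W M"
        using matches_add_vertex[OF G assms(4), of ?W M] assms(4) by auto
      then have "G.matches (insert s ?W) M" by (rule G.matches_mono) auto
      then obtain K where K: "M \<subseteq> K" "G.matches (insert s ?W) K" "card (insert s ?W - \<Union>K) = d"
        using ext_s M(2) unfolding G.extendable_def by metis
      obtain K' where K': "H.matches (insert x ?W) K'" "card K' = card K" "{e \<in> K. s \<notin> e} \<subseteq> K'"
        using replace[OF K(2)] by (elim exE conjE)
      have "s \<notin> e" if "e \<in> M" for e using G.matches_edge[OF MW that] sW by auto
      then have "M \<subseteq> K'" using K(1) K'(3) by auto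
      moreover have "card (insert x ?W) = card (insert s ?W)" using finW(1) sW assms(4) by simp
      then have "card (insert x ?W - \<Union>K') = d"
        using H.card_uncovered[OF _ K'(1)] G.card_uncovered[OF _ K(2)] K(3) K'(2) finW(1) by simp
      ultimately show ?thesis using K'(1) by metis
    next
      case True
      then obtain e where e: "e \<in> M" "x \<in> e" by (rule UnionE)
      have eE: "e \<in> edges ?H" "e \<subseteq> insert x ?W" using H.matches_edge[OF M(1) e(1)] by simp_all
      obtain v where v: "e = {x, v}" "v \<noteq> x" by (rule H.edge_other[OF eE(1) e(2)])
      have vW: "v \<in> ?W" using eE(2) v by simp
      let ?I = "insert v S" and ?M0 = "M - {e}"
      have VI: "?V - ?I = ?W - {v}" by auto
      have "\<Union>?M0 \<inter> e = {}" using H.matches_Diff_disjoint[OF M(1), of "{e}"] e(1) by simp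
      then have "\<Union>?M0 \<subseteq> ?V - ?I" using H.matches_Union[OF M(1)] v(1) unfolding VI by auto
      then have "H.matches (?V - ?I) ?M0"
        by (rule H.matches_restrict[OF H.matches_subset[OF M(1) Diff_subset]])
      then have M0: "G.matches (?V - ?I) ?M0"
        using matches_add_vertex[OF G assms(4), of "?V - ?I" ?M0] assms(4) by auto
      have "finite M" using H.matches_finite[OF _ M(1)] finW(1) by simp
      then have "Suc (card ?M0) = card M" using e(1) by (rule card_Suc_Diff1)
      \<comment> \<open>\<open>M\<close> contains \<open>e\<close>, so \<open>k - 1\<close> is
        positive and no truncation occurs.\<close>
      then have cM0: "card ?M0 + 2 = k" using M(2) by simp
      have "?I \<subseteq> ?V" "card ?I = n + 2" using SV vW finW(2) S(2) by auto
      note avoid = G.extend_avoiding[OF fin _ big par assms(2) this M0 cM0]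
      have "\<exists>M'. ?M0 \<subseteq> M' \<and> G.matches (?V - ?I) M' \<and> card (?V - ?I - \<Union>M') = d"
        by (rule avoid) (rule ext)
      then obtain M' where M': "?M0 \<subseteq> M'" "G.matches (?V - ?I) M'" "card (?V - ?I - \<Union>M') = d"
        by (elim exE conjE)
      have "H.matches (?V - ?I) M'"
        using M'(2) matches_add_vertex[OF G assms(4), of "?V - ?I" M'] assms(4) by auto
      then have "H.matches (insert x ?W) M'" by (rule H.matches_mono) auto
      moreover have "e \<inter> \<Union>M' = {}" using G.matches_Union[OF M'(2)] v(1) assms(4) by auto
      ultimately have "H.matches (insert x ?W) (insert e M')" using eE by (intro H.matches_insert)
      moreover have "insert x ?W - \<Union>(insert e M') = ?V - ?I - \<Union>M'"
        using v(1) assms(4) by auto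
      moreover have "M \<subseteq> insert e M'" using M'(1) by auto
      ultimately show ?thesis using M'(3) by metis
    qed
    moreover have "\<exists>M. H.matches (insert x ?W) M \<and> card M = k - 1"
      using ext_s replace unfolding G.extendable_def by metis
    ultimately show ?thesis unfolding H.extendable_def xW by simp
  qed
  moreover have "n + 1 + 2 * (k - 1) + d + 2 \<le> Suc (card ?V)" using big by simp
  moreover have "even (Suc (card ?V) + (n + 1) + d)" using par by simp
  ultimately show ?thesis unfolding nkd_graph_iff[OF H] vH cH by simp
qed

end
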